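(* Let $N$ and $l$ be positive integers. Suppose a binary image $F$ consists of $N$ ones and has a boundary of length $l$. Then $F$ contains a ball of radius $\left\lceil \sqrt{\frac{N}{l}} - 1 \right\rceil$.
   Context: A cell is a unit square in $\mathbb{R}^2$ whose vertices have integer coordinates. A binary image is a (finite) rectangle in $\mathbb{R}^2$ made up of cells, in which each cell has been assigned a value $0$ or $1$. A cell with value $1$ is called a one, a cell with value $0$ a zero; the image consists of $N$ ones if exactly $N$ of its cells have value $1$. Two cells are neighbours if they have a common edge. An edge of a cell belongs to the boundary of the image if it is the common edge of two neighbouring cells of the rectangle, one with value $1$ and one with value $0$, or if it belongs to exactly one cell of the rectangle (i.e. lies on the outer edge of the rectangle) and that cell has value $1$. The length of the boundary is the number of edges belonging to the boundary. For each one $c$, the distance to the boundary $d(c)$ is defined recursively: $d(c)=0$ if at least one edge of $c$ belongs to the boundary; otherwise $d(c)=1+\min\{d(c') : c' \text{ and } c \text{ are neighbours}\}$ (in that case all four neighbours of $c$ are ones). Equivalently, $d(c)$ is the least number of steps between neighbouring ones needed to get from $c$ to a one having an edge in the boundary. The image contains a ball with radius $k$ if there is a one $c$ with $d(c)\ge k$. *)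

theory Defs
  imports Complex_Main "HOL-Library.Z2"
begin

text \<open>The cell \<open>[x, x + 1] \<times> [y, y + 1]\<close> is represented by its lower left vertex \<open>(x, y)\<close>, and an
  edge by the set of its two endpoints.\<close>

type_synonym vertex = "int \<times> int"
type_synonym cell = "int \<times> int"
type_synonym edge = "vertex set"

definition cell_edges :: "cell \<Rightarrow> edge set" where
  "cell_edges c = (case c of (x, y) \<Rightarrow>
     {{(x, y), (x + 1, y)}, {(x, y + 1), (x + 1, y + 1)},
      {(x, y), (x, y + 1)}, {(x + 1, y), (x + 1, y + 1)}})"

definition neighbours :: "cell \<Rightarrow> cell \<Rightarrow> bool" where
  "neighbours c c' \<longleftrightarrow> c \<noteq> c' \<and> cell_edges c \<inter> cell_edges c' \<noteq> {}"

text \<open>The rectangle is \<open>[left, left + width] \<times> [bottom, bottom + height]\<close>. The function \<open>val\<close> is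
  only ever consulted on the cells of the rectangle.\<close>

record binary_image =
  left :: int
  bottom :: int
  width :: nat
  height :: nat
  val :: "cell \<Rightarrow> bit"

definition cells :: "binary_image \<Rightarrow> cell set" where
  "cells F = {left F ..< left F + int (width F)} \<times> {bottom F ..< bottom F + int (height F)}"

definition ones :: "binary_image \<Rightarrow> cell set" where
  "ones F = {c \<in> cells F. val F c = 1}"

definition zeros :: "binary_image \<Rightarrow> cell set" where
  "zeros F = {c \<in> cells F. val F c = 0}"

definition boundary :: "binary_image \<Rightarrow> edge set" where
  "boundary F =
     {e. \<exists>c \<in> ones F. \<exists>c' \<in> zeros F. neighbours c c' \<and> e \<in> cell_edges c \<inter> cell_edges c'} \<union>
     {e. \<exists>c \<in> ones F. {c' \<in> cells F. e \<in> cell_edges c'} = {c}}"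

definition boundary_cells :: "binary_image \<Rightarrow> cell set" where
  "boundary_cells F = {c \<in> ones F. cell_edges c \<inter> boundary F \<noteq> {}}"

definition one_steps :: "binary_image \<Rightarrow> cell rel" where
  "one_steps F = {(c, c'). c \<in> ones F \<and> c' \<in> ones F \<and> neighbours c c'}"

text \<open>The recursion for the distance does not terminate along all neighbours, so the distance is
  defined as the least number of steps to a boundary cell; the recursive equations, and the fact
  that they determine the distance, are proved below.\<close>

definition boundary_dist :: "binary_image \<Rightarrow> cell \<Rightarrow> nat" where
  "boundary_dist F c = (LEAST k. \<exists>b \<in> boundary_cells F. (c, b) \<in> one_steps F ^^ k)"

definition contains_ball :: "binary_image \<Rightarrow> nat \<Rightarrow> bool" where
  "contains_ball F k \<longleftrightarrow> (\<exists>c \<in> ones F. k \<le> boundary_dist F c)"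

lemma neighbours_iff:
  "neighbours (x, y) c \<longleftrightarrow> c \<in> {(x + 1, y), (x - 1, y), (x, y + 1), (x, y - 1)}"
  by (cases c) (auto simp: neighbours_def cell_edges_def doubleton_eq_iff)

lemma edge_eq_iff:
  fixes x y u v :: int
  shows "{(x, y), (x + 1, y)} = {(u, v), (u + 1, v)} \<longleftrightarrow> x = u \<and> y = v"
    and "{(x, y), (x, y + 1)} = {(u, v), (u, v + 1)} \<longleftrightarrow> x = u \<and> y = v"
    and "{(x, y), (x + 1, y)} \<noteq> {(u, v), (u, v + 1)}"
    and "{(x, y), (x, y + 1)} \<noteq> {(u, v), (u + 1, v)}"
  unfolding doubleton_eq_iff prod.inject by linarith+

lemma cell_edges_iff:
  "e \<in> cell_edges (x, y) \<longleftrightarrow>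
     e = {(x, y), (x + 1, y)} \<or> e = {(x, y + 1), (x + 1, y + 1)} \<or>
     e = {(x, y), (x, y + 1)} \<or> e = {(x + 1, y), (x + 1, y + 1)}"
  unfolding cell_edges_def by simp

lemma edge_cells_h: "{(x, y), (x + 1, y)} \<in> cell_edges d \<longleftrightarrow> d = (x, y) \<or> d = (x, y - 1)"
proof -
  obtain u v where d: "d = (u, v)" by (cases d)
  show ?thesis
    unfolding d cell_edges_iff edge_eq_iff prod.inject using edge_eq_iff(3) by auto
qed

lemma edge_cells_v: "{(x, y), (x, y + 1)} \<in> cell_edges d \<longleftrightarrow> d = (x, y) \<or> d = (x - 1, y)"
proof -
  obtain u v where d: "d = (u, v)" by (cases d)
  show ?thesis
    unfolding d cell_edges_iff edge_eq_iff prod.inject using edge_eq_iff(4) by auto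
qed

lemma edge_cases:
  assumes "e \<in> cell_edges c"
  shows "(\<exists>x y. e = {(x, y), (x + 1, y)}) \<or> (\<exists>x y. e = {(x, y), (x, y + 1)})"
proof -
  obtain x y where "c = (x, y)" by (cases c)
  then have "e = {(x, y), (x + 1, y)} \<or> e = {(x, y + 1), (x + 1, y + 1)} \<or>
      e = {(x, y), (x, y + 1)} \<or> e = {(x + 1, y), (x + 1, y + 1)}"
    using assms by (simp add: cell_edges_def)
  then show ?thesis by blast
qed

lemma edge_in_cells:
  assumes "e \<in> cell_edges c" "e \<in> cell_edges c'" "neighbours c c'" "e \<in> cell_edges d"
  shows "d = c \<or> d = c'"
proof -
  have ne: "c \<noteq> c'" using assms(3) by (simp add: neighbours_def)
  have *: "d = c \<or> d = c'" if pq: "\<And>d. e \<in> cell_edges d \<longleftrightarrow> d = p \<or> d = q" for p q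
  proof -
    have "c = p \<or> c = q" "c' = p \<or> c' = q" "d = p \<or> d = q"
      using pq[of c] pq[of c'] pq[of d] assms(1,2,4) by simp_all
    then show ?thesis using ne by (elim disjE) simp_all
  qed
  from edge_cases[OF assms(1)] show ?thesis
  proof (elim disjE exE)
    fix x y assume e: "e = {(x, y), (x + 1, y)}"
    show ?thesis by (rule *) (simp only: e edge_cells_h)
  next
    fix x y assume e: "e = {(x, y), (x, y + 1)}"
    show ?thesis by (rule *) (simp only: e edge_cells_v)
  qed
qed

lemma interior_neighbour_ones:
  assumes "c \<in> ones F" "c \<notin> boundary_cells F" "neighbours c c'"
  shows "c' \<in> ones F"
proof (rule ccontr)
  assume n: "c' \<notin> ones F"
  obtain e where e: "e \<in> cell_edges c" "e \<in> cell_edges c'"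
    using assms(3) by (auto simp: neighbours_def)
  have "e \<in> boundary F"
  proof (cases "c' \<in> cells F")
    case True
    then have "c' \<in> zeros F"
      using n by (auto simp: ones_def zeros_def)
    then show ?thesis
      using assms(1,3) e by (auto simp: boundary_def)
  next
    case False
    have "c \<in> cells F" using assms(1) by (simp add: ones_def)
    then have "{d \<in> cells F. e \<in> cell_edges d} = {c}"
      using edge_in_cells[OF e assms(3)] e(1) False by blast
    then show ?thesis
      using assms(1) by (auto simp: boundary_def)
  qed
  then show False
    using assms(1,2) e by (auto simp: boundary_cells_def)
qed

lemma ex_steps_to_boundary:
  assumes "c \<in> ones F"
  shows "\<exists>k. \<exists>b \<in> boundary_cells F. (c, b) \<in> one_steps F ^^ k"
  using assms
proof (induction "nat (fst c - left F)" arbitrary: c rule: less_induct)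
  case less
  obtain x y where c: "c = (x, y)" by (cases c)
  show ?case
  proof (cases "c \<in> boundary_cells F")
    case True
    then have "(c, c) \<in> one_steps F ^^ 0" by simp
    then show ?thesis using True by blast
  next
    case False
    let ?c = "(x - 1, y)"
    have nb: "neighbours c ?c" by (simp add: c neighbours_iff)
    then have one: "?c \<in> ones F"
      using interior_neighbour_ones less.prems False by blast
    then have "left F \<le> x - 1" by (auto simp: ones_def cells_def)
    then obtain k b where "b \<in> boundary_cells F" "(?c, b) \<in> one_steps F ^^ k"
      using less.hyps[of ?c] one by (auto simp: c)
    note b = this
    have "(c, ?c) \<in> one_steps F"
      using nb one less.prems by (simp add: one_steps_def)
    then have "(c, b) \<in> one_steps F ^^ Suc k" using b(2) by (rule relpow_Suc_I2)
    then show ?thesis using b(1) by blast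
  qed
qed

lemma boundary_dist_steps:
  assumes "c \<in> ones F"
  shows "\<exists>b \<in> boundary_cells F. (c, b) \<in> one_steps F ^^ boundary_dist F c"
  unfolding boundary_dist_def by (rule LeastI_ex[OF ex_steps_to_boundary[OF assms]])

lemma boundary_dist_le:
  "b \<in> boundary_cells F \<Longrightarrow> (c, b) \<in> one_steps F ^^ k \<Longrightarrow> boundary_dist F c \<le> k"
  unfolding boundary_dist_def by (rule Least_le) blast

lemma finite_neighbours: "finite {c'. neighbours c c'}"
  by (cases c) (simp add: neighbours_iff)

lemma neighbours_nonempty: "{c'. neighbours c c'} \<noteq> {}"
  by (cases c) (auto simp: neighbours_iff)

theorem boundary_dist_zero:
  assumes "c \<in> boundary_cells F"
  shows "boundary_dist F c = 0"
  using boundary_dist_le[OF assms, of c 0] by simp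

theorem boundary_dist_rec:
  assumes "c \<in> ones F" "c \<notin> boundary_cells F"
  shows "boundary_dist F c = 1 + Min (boundary_dist F ` {c'. neighbours c c'})"
proof -
  let ?M = "boundary_dist F ` {c'. neighbours c c'}"
  have M: "finite ?M" "?M \<noteq> {}"
    using finite_neighbours[of c] neighbours_nonempty[of c] by auto
  obtain b where b: "b \<in> boundary_cells F" "(c, b) \<in> one_steps F ^^ boundary_dist F c"
    using boundary_dist_steps assms(1) by blast
  then obtain k where k: "boundary_dist F c = Suc k"
    using assms(2) by (cases "boundary_dist F c") auto
  then obtain d where d: "(c, d) \<in> one_steps F" "(d, b) \<in> one_steps F ^^ k"
    using b(2) by (metis relpow_Suc_D2)
  then have "boundary_dist F d \<in> ?M" by (auto simp: one_steps_def)
  then have "Min ?M \<le> k"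
    using Min_le[OF M(1)] boundary_dist_le[OF b(1) d(2)] by (meson order_trans)
  moreover obtain c' where c': "neighbours c c'" "Min ?M = boundary_dist F c'"
    using Min_in[OF M] by auto
  have one: "c' \<in> ones F" using interior_neighbour_ones assms c'(1) by blast
  obtain b' where b': "b' \<in> boundary_cells F" "(c', b') \<in> one_steps F ^^ boundary_dist F c'"
    using boundary_dist_steps one by blast
  have "(c, b') \<in> one_steps F ^^ Suc (boundary_dist F c')"
    using b'(2) c'(1) one assms(1) by (intro relpow_Suc_I2) (auto simp: one_steps_def)
  then have "boundary_dist F c \<le> Suc (Min ?M)"
    using boundary_dist_le[OF b'(1)] c'(2) by simp
  ultimately show ?thesis using k by simp
qed

theorem boundary_dist_unique:
  fixes d :: "cell \<Rightarrow> nat"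
  assumes zero: "\<And>c. c \<in> boundary_cells F \<Longrightarrow> d c = 0"
    and rec: "\<And>c. c \<in> ones F \<Longrightarrow> c \<notin> boundary_cells F \<Longrightarrow> d c = 1 + Min (d ` {c'. neighbours c c'})"
    and c: "c \<in> ones F"
  shows "d c = boundary_dist F c"
proof (rule antisym)
  have le: "d c \<le> k" if "b \<in> boundary_cells F" "(c, b) \<in> one_steps F ^^ k" for b c k
    using that(2)
  proof (induction k arbitrary: c)
    case 0
    then show ?case using zero that(1) by simp
  next
    case (Suc k)
    obtain e where e: "(c, e) \<in> one_steps F" "(e, b) \<in> one_steps F ^^ k"
      using Suc.prems by (metis relpow_Suc_D2)
    show ?case
    proof (cases "c \<in> boundary_cells F")
      case True
      then show ?thesis using zero by simp
    next
      case False
      have "Min (d ` {c'. neighbours c c'}) \<le> d e"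
        using e(1) finite_neighbours[of c] by (intro Min_le) (auto simp: one_steps_def)
      then show ?thesis
        using rec[of c] False e(1) Suc.IH[OF e(2)] by (auto simp: one_steps_def)
    qed
  qed
  show "d c \<le> boundary_dist F c"
    using boundary_dist_steps[OF c] le by blast
  show "boundary_dist F c \<le> d c"
    using c
  proof (induction "d c" arbitrary: c rule: less_induct)
    case less
    show ?case
    proof (cases "c \<in> boundary_cells F")
      case True
      then show ?thesis by (simp add: boundary_dist_zero)
    next
      case False
      have "Min (d ` {c'. neighbours c c'}) \<in> d ` {c'. neighbours c c'}"
        using finite_neighbours[of c] neighbours_nonempty[of c] by (intro Min_in) auto
      then obtain e where e: "neighbours c e" "Min (d ` {c'. neighbours c c'}) = d e" by auto
      have dc: "d c = Suc (d e)" using rec[OF less.prems False] e(2) by simp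
      have "boundary_dist F e \<le> d e"
        using less.hyps[of e] dc interior_neighbour_ones[OF less.prems False e(1)] by simp
      moreover have "Min (boundary_dist F ` {c'. neighbours c c'}) \<le> boundary_dist F e"
        using e(1) finite_neighbours[of c] by (intro Min_le) auto
      ultimately show ?thesis
        using boundary_dist_rec[OF less.prems False] dc by simp
    qed
  qed
qed

end

theory Submission imports Defs
begin

text \<open>Let \<open>k\<close> be the claimed radius, so that \<open>k\<^sup>2 * l < N\<close> unless \<open>k = 0\<close>. A boundary edge separates a one \<open>b\<close>
  from a cell \<open>z\<close> which is not a one; assign to it the half of the \<open>\<ell>\<^sub>1\<close>-ball of radius \<open>k - 1\<close> around
  \<open>b\<close> that points away from \<open>z\<close>. It has \<open>1 + 3 + \<dots> + (2 * k - 1) = k\<^sup>2\<close> cells. If all distances to the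
  boundary were below \<open>k\<close>, these half balls would cover the ones: for a one \<open>c\<close>, let \<open>z\<close> be a cell
  that is nearest to \<open>c\<close> among those which are not ones; a step from \<open>z\<close> towards \<open>c\<close> leads to a one.
  Hence \<open>N \<le> k\<^sup>2 * l\<close>, a contradiction.\<close>

definition cell_dist :: "cell \<Rightarrow> cell \<Rightarrow> int" where
  "cell_dist c d = \<bar>fst c - fst d\<bar> + \<bar>snd c - snd d\<bar>"

text \<open>The second condition says that \<open>c - b\<close> has nonpositive inner product with
  the unit vector \<open>z - b\<close>; the row through \<open>b\<close> itself is included.\<close>

definition half_ball :: "nat \<Rightarrow> cell \<Rightarrow> cell \<Rightarrow> cell set" where
  "half_ball k b z = {c. cell_dist c b < int k \<and>
     (fst c - fst b) * (fst z - fst b) + (snd c - snd b) * (snd z - snd b) \<le> 0}"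

text \<open>Boundary edges as seen from the one: \<open>z\<close> may lie outside the rectangle, so
  both kinds of boundary edge are treated alike.\<close>

definition exits :: "binary_image \<Rightarrow> (cell \<times> cell) set" where
  "exits F = {(b, z). b \<in> ones F \<and> z \<notin> ones F \<and> neighbours b z}"

lemma cell_dist_triangle: "cell_dist c e \<le> cell_dist c d + cell_dist d e"
  by (simp add: cell_dist_def)

lemma cell_dist_neighbours:
  assumes "neighbours c d"
  shows "cell_dist c d = 1"
  using assms by (cases c) (auto simp: neighbours_iff cell_dist_def)

lemma cell_dist_steps:
  assumes "(c, b) \<in> one_steps F ^^ n"
  shows "cell_dist c b \<le> int n"
  using assms
proof (induction n arbitrary: c)
  case 0
  then show ?case by (simp add: cell_dist_def)
next
  case (Suc n)
  obtain d where d: "(c, d) \<in> one_steps F" "(d, b) \<in> one_steps F ^^ n"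
    using Suc.prems by (metis relpow_Suc_D2)
  then show ?case
    using Suc.IH[OF d(2)] cell_dist_neighbours[of c d] cell_dist_triangle[of c b d]
    by (auto simp: one_steps_def)
qed

section \<open>Size of a half ball\<close>

text \<open>A model of the half ball: \<open>i\<close> is the depth measured away from
  \<open>z\<close>, \<open>j\<close> the sideways offset, and
  \<open>i + \<bar>j\<bar> < k\<close>.\<close>

definition triangle :: "nat \<Rightarrow> (nat \<times> int) set" where
  "triangle k = (SIGMA i:{..<k}. {- int (k - Suc i)..int (k - Suc i)})"

lemma finite_triangle: "finite (triangle k)"
  by (simp add: triangle_def)

lemma card_triangle: "card (triangle k) = k\<^sup>2"
proof -
  have odd_sum: "(\<Sum>i<k. 2 * i + 1) = k\<^sup>2"
    by (induction k) (simp_all add: power2_eq_square)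
  have "card (triangle k) = (\<Sum>i<k. 2 * (k - Suc i) + 1)"
    unfolding triangle_def by (subst card_SigmaI) (auto intro!: sum.cong)
  \<comment> \<open>The rows shrink with the depth; reversing their order gives the first
    \<open>k\<close> odd numbers.\<close>
  also have "\<dots> = (\<Sum>i<k. 2 * i + 1)"
    by (rule sum.nat_diff_reindex)
  finally show ?thesis using odd_sum by simp
qed

text \<open>Taking \<open>b\<close> as origin and the line through \<open>b\<close> and
  \<open>z\<close> as an axis turns the half ball into \<open>triangle k\<close>. An inclusion
  suffices for an upper bound on its size.\<close>

lemma half_ball_subset_image:
  assumes "neighbours b z"
  shows "half_ball k b z \<subseteq> (\<lambda>(i, j).
    (fst b - int i * (fst z - fst b) - j * (snd z - snd b),
     snd b - int i * (snd z - snd b) + j * (fst z - fst b))) ` triangle k"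
    (is "_ \<subseteq> ?f ` _")
proof
  fix c assume c: "c \<in> half_ball k b z"
  define s t where "s = fst z - fst b" and "t = snd z - snd b"
  define i where "i = - ((fst c - fst b) * s + (snd c - snd b) * t)"
  define j where "j = (snd c - snd b) * s - (fst c - fst b) * t"
  have st: "(s = 1 \<or> s = -1) \<and> t = 0 \<or> s = 0 \<and> (t = 1 \<or> t = -1)"
    using assms by (cases b) (auto simp: neighbours_iff s_def t_def)
  have i: "0 \<le> i" using c by (simp add: half_ball_def i_def s_def t_def)
  \<comment> \<open>As \<open>(s, t)\<close> is a signed unit vector of an axis, the new coordinates
    are the old ones up to order and signs.\<close>
  have "\<bar>i\<bar> + \<bar>j\<bar> = cell_dist c b"
    using st by (auto simp: i_def j_def cell_dist_def)
  then have "i + \<bar>j\<bar> < int k" using c i by (simp add: half_ball_def)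
  then have "(nat i, j) \<in> triangle k"
    using i by (auto simp: triangle_def)
  moreover have "c = ?f (nat i, j)"
    using i st unfolding s_def[symmetric] t_def[symmetric]
    by (cases c) (auto simp: i_def j_def s_def[symmetric] t_def[symmetric])
  ultimately show "c \<in> ?f ` triangle k" by (rule rev_image_eqI)
qed

lemma card_half_ball_le:
  assumes "neighbours b z"
  shows "card (half_ball k b z) \<le> k\<^sup>2"
  using surj_card_le[OF finite_triangle half_ball_subset_image[OF assms]]
  by (simp add: card_triangle)

section \<open>Exits and boundary edges\<close>

lemma exit_edge_in_boundary:
  assumes "(b, z) \<in> exits F" "e \<in> cell_edges b" "e \<in> cell_edges z"
  shows "e \<in> boundary F"
proof -
  have b: "b \<in> ones F" and z: "z \<notin> ones F" and nb: "neighbours b z"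
    using assms(1) by (auto simp: exits_def)
  show ?thesis
  proof (cases "z \<in> cells F")
    case True
    then have "z \<in> zeros F" using z by (auto simp: ones_def zeros_def)
    then show ?thesis using b nb assms(2,3) by (auto simp: boundary_def)
  next
    case False
    have "b \<in> cells F" using b by (simp add: ones_def)
    then have "{d \<in> cells F. e \<in> cell_edges d} = {b}"
      using edge_in_cells[OF assms(2,3) nb] assms(2) False by blast
    then show ?thesis using b by (auto simp: boundary_def)
  qed
qed

text \<open>An edge shared by two neighbours lies in no third cell, so it determines both cells of
  its exit. Hence there are at most as many exits as boundary edges.\<close>

lemma exits_subset_image:
  "exits F \<subseteq> (\<lambda>e. (THE b. b \<in> ones F \<and> e \<in> cell_edges b, THE z. z \<notin> ones F \<and> e \<in> cell_edges z))
     ` boundary F"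
proof clarify
  fix b z assume bz: "(b, z) \<in> exits F"
  then have b: "b \<in> ones F" and z: "z \<notin> ones F" and nb: "neighbours b z"
    by (auto simp: exits_def)
  obtain e where e: "e \<in> cell_edges b" "e \<in> cell_edges z"
    using nb by (auto simp: neighbours_def)
  have "(THE b. b \<in> ones F \<and> e \<in> cell_edges b) = b"
    using b z e edge_in_cells[OF e nb] by blast
  moreover have "(THE z. z \<notin> ones F \<and> e \<in> cell_edges z) = z"
    using b z e edge_in_cells[OF e nb] by blast
  ultimately show "(b, z) \<in> (\<lambda>e. (THE b. b \<in> ones F \<and> e \<in> cell_edges b,
      THE z. z \<notin> ones F \<and> e \<in> cell_edges z)) ` boundary F"
    using exit_edge_in_boundary[OF bz e] by force
qed

lemma edge_shared_with_neighbour: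
  assumes "e \<in> cell_edges b"
  shows "\<exists>d. neighbours b d \<and> e \<in> cell_edges d"
proof -
  obtain x y where b: "b = (x, y)" by (cases b)
  consider (bottom) "e = {(x, y), (x + 1, y)}" | (top) "e = {(x, y + 1), (x + 1, y + 1)}"
    | (left) "e = {(x, y), (x, y + 1)}" | (right) "e = {(x + 1, y), (x + 1, y + 1)}"
    using assms unfolding b cell_edges_iff by blast
  then show ?thesis
  proof cases
    case bottom
    then have "e \<in> cell_edges (x, y - 1)" by (simp only: edge_cells_h simp_thms)
    then show ?thesis unfolding b neighbours_iff by blast
  next
    case top
    then have "e \<in> cell_edges (x, y + 1)" by (simp only: edge_cells_h simp_thms)
    then show ?thesis unfolding b neighbours_iff by blast
  next
    case left
    then have "e \<in> cell_edges (x - 1, y)" by (simp only: edge_cells_v simp_thms)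
    then show ?thesis unfolding b neighbours_iff by blast
  next
    case right
    then have "e \<in> cell_edges (x + 1, y)" by (simp only: edge_cells_v simp_thms)
    then show ?thesis unfolding b neighbours_iff by blast
  qed
qed

text \<open>If all neighbours were ones, every edge of \<open>b\<close> would lie between two ones
  of the rectangle, which fits neither kind of boundary edge.\<close>

lemma boundary_cell_exit:
  assumes "b \<in> boundary_cells F"
  shows "\<exists>z. z \<notin> ones F \<and> neighbours b z"
proof (rule ccontr)
  assume "\<not> ?thesis"
  then have all: "d \<in> ones F" if "neighbours b d" for d using that by blast
  obtain e where e: "e \<in> cell_edges b" "e \<in> boundary F" and b: "b \<in> ones F"
    using assms unfolding boundary_cells_def by blast
  obtain d where d: "neighbours b d" "e \<in> cell_edges d"
    using edge_shared_with_neighbour[OF e(1)] by blast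
  have bd: "b \<noteq> d" "b \<in> cells F" "d \<in> cells F"
    using d(1) all[OF d(1)] b by (auto simp: neighbours_def ones_def)
  from e(2) show False
    unfolding boundary_def
  proof (elim UnE CollectE bexE conjE)
    fix c c' assume "c \<in> ones F" "c' \<in> zeros F" "neighbours c c'" "e \<in> cell_edges c \<inter> cell_edges c'"
    then have "c' = b \<or> c' = d" using edge_in_cells[OF e(1) d(2,1)] by blast
    then show False
      using b all[OF d(1)] \<open>c' \<in> zeros F\<close> by (auto simp: ones_def zeros_def)
  next
    fix c assume "{c' \<in> cells F. e \<in> cell_edges c'} = {c}"
    moreover have "{b, d} \<subseteq> {c' \<in> cells F. e \<in> cell_edges c'}"
      using bd e(1) d(2) by blast
    ultimately show False using bd(1) by simp
  qed
qed

section \<open>Covering the ones by half balls\<close>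

lemma ones_in_half_ball:
  assumes c: "c \<in> ones F" and dist: "boundary_dist F c < k"
  shows "\<exists>(b, z) \<in> exits F. c \<in> half_ball k b z"
proof -
  obtain b0 where b0: "b0 \<in> boundary_cells F" "(c, b0) \<in> one_steps F ^^ boundary_dist F c"
    using boundary_dist_steps[OF c] by blast
  obtain z0 where z0: "z0 \<notin> ones F" "neighbours b0 z0"
    using boundary_cell_exit[OF b0(1)] by blast
  \<comment> \<open>At most \<open>k - 1\<close> steps lead to \<open>b0\<close>, and one more
    leaves the ones.\<close>
  have z0_le: "cell_dist c z0 \<le> int k"
    using cell_dist_steps[OF b0(2)] cell_dist_neighbours[OF z0(2)]
      cell_dist_triangle[of c z0 b0] dist by linarith
  have dist_nonneg: "0 \<le> cell_dist c d" for d
    by (simp add: cell_dist_def)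
  obtain z where z: "z \<notin> ones F"
      and "\<forall>d. d \<notin> ones F \<longrightarrow> nat (cell_dist c z) \<le> nat (cell_dist c d)"
    using ex_has_least_nat[of "\<lambda>z. z \<notin> ones F" z0 "\<lambda>z. nat (cell_dist c z)"] z0(1) by blast
  then have z_min: "cell_dist c z \<le> cell_dist c d" if "d \<notin> ones F" for d
    using that dist_nonneg nat_le_eq_zle by blast
  have z_le: "cell_dist c z \<le> int k" using z_min[OF z0(1)] z0_le by linarith
  have closer: "d \<in> ones F" if "cell_dist c d < cell_dist c z" for d
    using z_min[of d] that by fastforce
  obtain p q where pq: "c = (p, q)" by (cases c)
  obtain u v where uv: "z = (u, v)" by (cases z)
  \<comment> \<open>Since \<open>c\<close> is a one and \<open>z\<close> is not, they differ in a
    coordinate. A step from \<open>z\<close> along it towards \<open>c\<close> lowers the distance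
    by one, to below \<open>k\<close>, and so reaches a one \<open>b\<close>; in this coordinate
    \<open>c\<close> does not lie beyond \<open>b\<close> on the side of \<open>z\<close>.\<close>
  consider "p < u" | "u < p" | "q < v" | "v < q"
    using c z pq uv by (metis linorder_less_linear)
  then show ?thesis
  proof cases
    case 1
    then have "((u - 1, v), z) \<in> exits F" "c \<in> half_ball k (u - 1, v) z"
      using closer[of "(u - 1, v)"] z z_le
      by (auto simp: exits_def half_ball_def neighbours_iff cell_dist_def pq uv)
    then show ?thesis by blast
  next
    case 2
    then have "((u + 1, v), z) \<in> exits F" "c \<in> half_ball k (u + 1, v) z"
      using closer[of "(u + 1, v)"] z z_le
      by (auto simp: exits_def half_ball_def neighbours_iff cell_dist_def pq uv)
    then show ?thesis by blast
  next
    case 3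
    then have "((u, v - 1), z) \<in> exits F" "c \<in> half_ball k (u, v - 1) z"
      using closer[of "(u, v - 1)"] z z_le
      by (auto simp: exits_def half_ball_def neighbours_iff cell_dist_def pq uv)
    then show ?thesis by blast
  next
    case 4
    then have "((u, v + 1), z) \<in> exits F" "c \<in> half_ball k (u, v + 1) z"
      using closer[of "(u, v + 1)"] z z_le
      by (auto simp: exits_def half_ball_def neighbours_iff cell_dist_def pq uv)
    then show ?thesis by blast
  qed
qed

lemma card_ones_le:
  assumes fin: "finite (boundary F)" and no_ball: "\<not> contains_ball F k"
  shows "card (ones F) \<le> card (boundary F) * k\<^sup>2"
proof -
  have fin_exits: "finite (exits F)"
    using exits_subset_image fin by (rule finite_surj[rotated])
  have half: "finite (half_ball k b z)" "card (half_ball k b z) \<le> k\<^sup>2" if "(b, z) \<in> exits F" for b z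
    using that finite_surj[OF finite_triangle half_ball_subset_image] card_half_ball_le
    by (auto simp: exits_def)
  let ?U = "\<Union>(b, z) \<in> exits F. half_ball k b z"
  have "ones F \<subseteq> ?U"
  proof
    fix c assume c: "c \<in> ones F"
    then have "boundary_dist F c < k"
      using no_ball by (auto simp: contains_ball_def not_le)
    then show "c \<in> ?U" using ones_in_half_ball[OF c] by blast
  qed
  then have "card (ones F) \<le> card ?U"
    using fin_exits half(1) by (intro card_mono) auto
  also have "\<dots> \<le> (\<Sum>(b, z) \<in> exits F. card (half_ball k b z))"
    using card_UN_le[OF fin_exits, of "\<lambda>(b, z). half_ball k b z"]
    by (simp add: case_prod_unfold)
  also have "\<dots> \<le> card (exits F) * k\<^sup>2"
    using sum_bounded_above[of "exits F" "\<lambda>(b, z). card (half_ball k b z)" "k\<^sup>2"] half(2)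
    by auto
  also have "\<dots> \<le> card (boundary F) * k\<^sup>2"
    using surj_card_le[OF fin exits_subset_image] by (rule mult_right_mono) simp
  finally show ?thesis .
qed

theorem theorem4:
  fixes F :: binary_image and N l :: nat
  assumes "N > 0" and "l > 0"
    and "card (ones F) = N"
    and "card (boundary F) = l"
  shows "contains_ball F (nat \<lceil>sqrt (real N / real l) - 1\<rceil>)"
proof (rule ccontr)
  define k where "k = nat \<lceil>sqrt (real N / real l) - 1\<rceil>"
  assume "\<not> contains_ball F (nat \<lceil>sqrt (real N / real l) - 1\<rceil>)"
  then have no_ball: "\<not> contains_ball F k" by (simp add: k_def)
  \<comment> \<open>Infinite sets have \<open>card\<close> equal to \<open>0\<close>, so
    \<open>l > 0\<close> gives finiteness.\<close>
  have "finite (boundary F)" using assms(2,4) card_ge_0_finite by blast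
  then have "N \<le> l * k\<^sup>2" using card_ones_le[OF _ no_ball] assms(3,4) by simp
  then have "real N \<le> real l * (real k)\<^sup>2"
    by (metis of_nat_le_iff of_nat_mult of_nat_power)
  then have "real N / real l \<le> (real k)\<^sup>2"
    using assms(2) by (simp add: divide_le_eq mult.commute)
  then have "sqrt (real N / real l) \<le> real k" by (simp add: real_le_lsqrt)
  \<comment> \<open>Rounding up satisfies \<open>\<lceil>x - 1\<rceil> < x\<close>. For a negative
    ceiling \<open>nat\<close> would return \<open>0\<close>, which is still below the positive
    root.\<close>
  moreover have "real k < sqrt (real N / real l)"
  proof (cases "0 \<le> \<lceil>sqrt (real N / real l) - 1\<rceil>")
    case True
    then show ?thesis unfolding k_def by linarith
  next
    case False
    then show ?thesis using assms(1,2) by (simp add: k_def)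
  qed
  ultimately show False by simp
qed

end
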